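(* Let $A\in\mathcal{M}_{m\times n}(\mathbb{N})$ be a matrix with non-zero columns, let $I_A$ be the toric ideal of $A$ in $R=\mathbb{K}[e_1,\dots,e_n]$, and let $\boldsymbol{m}=e_1\cdots e_n$. Let $\mathcal{C}$ be a basis of the lattice $\ker(A)\subseteq\mathbb{Z}^n$ and let $J=(f_v\mid v\in\mathcal{C})\subseteq R$. Then for every integer $t\ge1$, $$I_A^{(t)}=J^t:\boldsymbol{m}^\infty.$$
   Context: $\mathbb{K}$ is an algebraically closed field of characteristic zero, and $\mathbb{N}$ includes $0$. For $\alpha\in\mathbb{N}^n$, $e^\alpha=e_1^{\alpha_1}\cdots e_n^{\alpha_n}$. Let $A\in\mathcal{M}_{m\times n}(\mathbb{N})$ have columns $\varsigma_1,\dots,\varsigma_n\in\mathbb{N}^m$, all non-zero. The map $\varphi_A:\mathbb{K}[e_1,\dots,e_n]\to\mathbb{K}[x_1,\dots,x_m]$ is the $\mathbb{K}$-algebra homomorphism with $\varphi_A(e_i)=x^{\varsigma_i}$, and the toric ideal of $A$ is $I_A=\ker(\varphi_A)$, a prime ideal. $\ker(A)$ denotes the kernel of the $\mathbb{Z}$-linear map $\mathbb{Z}^n\to\mathbb{Z}^m$ given by multiplication by $A$. Each $u\in\mathbb{Z}^n$ is written uniquely as $u=u^+-u^-$ with $u^+,u^-\in\mathbb{N}^n$ of disjoint support, and $f_u=e^{u^+}-e^{u^-}$. The $t$-th symbolic power of the prime ideal $I_A$ is $I_A^{(t)}=I_A^tR_{I_A}\cap R=\{f\in R\mid fg\in I_A^t\text{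 for some }g\notin I_A\}$. For an ideal $L\subseteq R$, $L:\boldsymbol{m}^\infty=\{f\in R\mid f\boldsymbol{m}^a\in L\text{ for some integer }a\ge0\}$. *)

theory Defs
  imports
    "HOL-Analysis.Finite_Cartesian_Product"
    "HOL-Computational_Algebra.Polynomial"
    "HOL-Library.Poly_Mapping"
begin

section \<open>Ideals of a commutative ring\<close>

text \<open>An ideal of a commutative ring is a submodule of the ring regarded as a module over itself;
  in particular \<open>ring_ideal.span S\<close> is the ideal \<open>(S)\<close> generated by \<open>S\<close>.\<close>

global_interpretation ring_ideal: module "(*) :: 'a::comm_ring_1 \<Rightarrow> 'a \<Rightarrow> 'a"
  by unfold_locales (simp_all add: algebra_simps)

definition ideal_mult :: "'a::comm_ring_1 set \<Rightarrow> 'a set \<Rightarrow> 'a set" where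
  "ideal_mult L M = ring_ideal.span {f * g | f g. f \<in> L \<and> g \<in> M}"

primrec ideal_power :: "'a::comm_ring_1 set \<Rightarrow> nat \<Rightarrow> 'a set" where
  "ideal_power L 0 = UNIV"
| "ideal_power L (Suc t) = ideal_mult L (ideal_power L t)"

text \<open>Only meant for a prime ideal \<open>P\<close>.\<close>

definition symbolic_power :: "'a::comm_ring_1 set \<Rightarrow> nat \<Rightarrow> 'a set" where
  "symbolic_power P t = {f. \<exists>g. g \<notin> P \<and> f * g \<in> ideal_power P t}"

text \<open>The saturation \<open>L : h\<^sup>\<infinity>\<close> of \<open>L\<close> by a single element \<open>h\<close>.\<close>

definition saturation :: "'a::comm_ring_1 set \<Rightarrow> 'a \<Rightarrow> 'a set" where
  "saturation L h = {f. \<exists>a::nat. f * h ^ a \<in> L}"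

section \<open>Polynomial rings\<close>

text \<open>Polynomials with coefficients in \<open>'k\<close> in the variables indexed by \<open>'n\<close>: finitely supported
  functions from exponent vectors to coefficients, multiplied by convolution.\<close>

type_synonym ('n, 'k) mvpoly = "('n \<Rightarrow>\<^sub>0 nat) \<Rightarrow>\<^sub>0 'k"

definition mvVar :: "'n \<Rightarrow> ('n, 'k::comm_ring_1) mvpoly" where
  "mvVar i = Poly_Mapping.single (Poly_Mapping.single i 1) 1"

definition mvConst :: "'k::comm_ring_1 \<Rightarrow> ('n, 'k) mvpoly" where
  "mvConst c = Poly_Mapping.single 0 c"

definition mvMonom :: "nat ^ 'n::finite \<Rightarrow> ('n, 'k::comm_ring_1) mvpoly" where
  "mvMonom \<alpha> = (\<Prod>i\<in>UNIV. mvVar i ^ (\<alpha> $ i))"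

section \<open>Toric ideals\<close>

text \<open>The algebra homomorphism \<open>e\<^sub>i \<mapsto> x\<^bsup>\<varsigma>\<^sub>i\<^esup>\<close>, where \<open>\<varsigma>\<^sub>i\<close> is the \<open>i\<close>-th column of \<open>A\<close>, given by
  substitution into each term of \<open>f\<close>; the lemmas below confirm that it is that homomorphism.\<close>

definition toric_map ::
    "nat ^ 'n::finite ^ 'm::finite \<Rightarrow> ('n, 'k::comm_ring_1) mvpoly \<Rightarrow> ('m, 'k) mvpoly" where
  "toric_map A f = (\<Sum>\<alpha>\<in>Poly_Mapping.keys f. mvConst (Poly_Mapping.lookup f \<alpha>) *
     (\<Prod>i\<in>UNIV. mvMonom (column i A) ^ Poly_Mapping.lookup \<alpha> i))"

lemma mvConst_zero [simp]: "mvConst 0 = 0"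
  by (simp add: mvConst_def)

lemma mvConst_add: "mvConst (c + d) = mvConst c + mvConst d"
  by (simp add: mvConst_def single_add)

lemma mvConst_mult: "mvConst (c * d) = mvConst c * mvConst d"
  by (simp add: mvConst_def mult_single)

lemma toric_map_superset:
  assumes "finite S" "Poly_Mapping.keys f \<subseteq> S"
  shows "toric_map A f = (\<Sum>\<alpha>\<in>S. mvConst (Poly_Mapping.lookup f \<alpha>) *
     (\<Prod>i\<in>UNIV. mvMonom (column i A) ^ Poly_Mapping.lookup \<alpha> i))"
  unfolding toric_map_def using assms
  by (intro sum.mono_neutral_left) (auto simp: in_keys_iff)

lemma toric_map_single:
  "toric_map A (Poly_Mapping.single \<alpha> c) =
     mvConst c * (\<Prod>i\<in>UNIV. mvMonom (column i A) ^ Poly_Mapping.lookup \<alpha> i)"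
  by (subst toric_map_superset[where S = "{\<alpha>}"]) auto

lemma toric_map_add: "toric_map A (f + g) = toric_map A f + toric_map A g"
  by (subst (1 2 3) toric_map_superset[where S = "Poly_Mapping.keys f \<union> Poly_Mapping.keys g"])
     (use Poly_Mapping.keys_add[of f g] in
       \<open>auto simp: lookup_add mvConst_add algebra_simps sum.distrib\<close>)

lemma toric_map_zero [simp]: "toric_map A 0 = 0"
  by (simp add: toric_map_def)

lemma toric_map_sum: "toric_map A (sum f S) = (\<Sum>x\<in>S. toric_map A (f x))"
  by (induction S rule: infinite_finite_induct) (auto simp: toric_map_add)

lemma mvpoly_expand:
  fixes f :: "('n, 'k::comm_ring_1) mvpoly"
  shows "f = (\<Sum>\<alpha>\<in>Poly_Mapping.keys f. Poly_Mapping.single \<alpha> (Poly_Mapping.lookup f \<alpha>))"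
  by (rule poly_mapping_eqI)
     (simp add: lookup_sum lookup_single when_def sum.delta in_keys_iff)

lemma toric_map_single_mult:
  "toric_map A (Poly_Mapping.single \<alpha> c * Poly_Mapping.single \<beta> d) =
     toric_map A (Poly_Mapping.single \<alpha> c) * toric_map A (Poly_Mapping.single \<beta> d)"
  by (simp only: mult_single toric_map_single mvConst_mult lookup_add power_add
        prod.distrib mult_ac)

lemma toric_map_mult: "toric_map A (f * g) = toric_map A f * toric_map A g"
proof -
  let ?F = "\<lambda>\<alpha>. Poly_Mapping.single \<alpha> (Poly_Mapping.lookup f \<alpha>)"
  let ?G = "\<lambda>\<beta>. Poly_Mapping.single \<beta> (Poly_Mapping.lookup g \<beta>)"
  have "f * g = (\<Sum>\<alpha>\<in>Poly_Mapping.keys f. ?F \<alpha>) * (\<Sum>\<beta>\<in>Poly_Mapping.keys g. ?G \<beta>)"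
    by (rule arg_cong2[where f = "(*)"]) (rule mvpoly_expand)+
  then have "toric_map A (f * g) =
      toric_map A (\<Sum>\<alpha>\<in>Poly_Mapping.keys f. \<Sum>\<beta>\<in>Poly_Mapping.keys g. ?F \<alpha> * ?G \<beta>)"
    by (simp only: sum_product)
  also have "\<dots> = (\<Sum>\<alpha>\<in>Poly_Mapping.keys f. toric_map A (?F \<alpha>)) *
                   (\<Sum>\<beta>\<in>Poly_Mapping.keys g. toric_map A (?G \<beta>))"
    by (simp only: toric_map_sum toric_map_single_mult sum_product)
  also have "\<dots> = toric_map A f * toric_map A g"
    by (simp only: toric_map_sum[symmetric] mvpoly_expand[symmetric])
  finally show ?thesis .
qed

lemma toric_map_const: "toric_map A (mvConst c) = mvConst c"
  unfolding mvConst_def by (subst toric_map_single) (simp add: mvConst_def)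

lemma toric_map_one [simp]: "toric_map A 1 = 1"
  using toric_map_const[of A 1] by (simp add: mvConst_def)

lemma toric_map_var: "toric_map A (mvVar i) = mvMonom (column i A)"
  unfolding mvVar_def
  by (subst toric_map_single)
     (simp add: mvConst_def lookup_single when_def if_distrib[of "power _"] cong: if_cong)

definition toric_ideal ::
    "nat ^ 'n::finite ^ 'm::finite \<Rightarrow> ('n, 'k::comm_ring_1) mvpoly set" where
  "toric_ideal A = {f. toric_map A f = 0}"

section \<open>The lattice of a matrix and its binomials\<close>

global_interpretation int_lattice: module "(*s) :: int \<Rightarrow> int ^ 'n \<Rightarrow> int ^ 'n"
  by unfold_locales (simp_all only: vec_eq_iff vector_smult_component vector_add_component
      distrib_left distrib_right mult.assoc mult_1 simp_thms)

definition matrix_kernel :: "nat ^ 'n::finite ^ 'm::finite \<Rightarrow> (int ^ 'n) set" where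
  "matrix_kernel A = {u. map_matrix int A *v u = 0}"

definition lattice_basis :: "(int ^ 'n) set \<Rightarrow> (int ^ 'n) set \<Rightarrow> bool" where
  "lattice_basis C \<Lambda> \<longleftrightarrow> int_lattice.independent C \<and> int_lattice.span C = \<Lambda>"

definition vec_pos :: "int ^ 'n \<Rightarrow> nat ^ 'n" where
  "vec_pos u = (\<chi> i. nat (u $ i))"

definition vec_neg :: "int ^ 'n \<Rightarrow> nat ^ 'n" where
  "vec_neg u = (\<chi> i. nat (- (u $ i)))"

definition lattice_binomial :: "int ^ 'n::finite \<Rightarrow> ('n, 'k::comm_ring_1) mvpoly" where
  "lattice_binomial u = mvMonom (vec_pos u) - mvMonom (vec_neg u)"

end

theory Submission
  imports Defs "HOL-Analysis.Cartesian_Space"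
begin

text \<open>Write \<open>I\<close> for the toric ideal, \<open>m\<close> for the product of the variables and \<open>Q\<^sub>s\<close> for the saturation
  of \<open>J\<^sup>s\<close> by \<open>m\<close>.

  Two monomials with the same image under the toric map differ by a lattice binomial times a
  monomial, and moving along the lattice in steps of the basis is possible once enough room is made
  by multiplying with monomials; so \<open>I \<subseteq> Q\<^sub>1\<close> (\<open>toric_ideal_subset_saturation\<close>). As \<open>I\<close> is prime, contains
  \<open>J\<close> and contains no monomial, \<open>I = Q\<^sub>1\<close>, and \<open>Q\<^sub>t\<close> is contained in the symbolic power, a power of \<open>m\<close>
  being the required multiplier outside \<open>I\<close>.

  For the other inclusion, \<open>f g \<in> I\<^sup>t\<close> implies \<open>f g \<in> Q\<^sub>t\<close>, and it has to be shown that \<open>g \<notin> I\<close> can be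
  cancelled. Geometrically, after inverting the variables \<open>J\<close> cuts out a smooth complete intersection
  (a subtorus), whose powers have no embedded components. The argument given here avoids the
  associated graded ring by means of derivations, using characteristic zero. Functionals dual to the
  lattice basis give derivations \<open>D\<^sub>v\<close> that lower the order along \<open>J\<close> by at most one, and a combination
  of them with coefficients in \<open>J\<close> is an Euler operator: up to a unit of the Laurent ring it acts on
  \<open>J\<^sup>s\<close> modulo \<open>J\<^bsup>s+1\<^esup>\<close> as multiplication by \<open>s\<close> (\<open>lattice_ideal_euler\<close>, \<open>euler_saturation\<close>). The order of
  \<open>f\<close> is thus determined by the orders of the \<open>D\<^sub>v f\<close>, and induction on the order reduces cancellation
  of \<open>g\<close> to the primality of \<open>I\<close> (\<open>saturation_power_cancel\<close>).\<close>

text \<open>Read in the ring acting on itself, this rule of modules reassociates products to the left and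
  makes the simplifier loop with the commutative normalisation of products.\<close>
declare ring_ideal.scale_scale [simp del]

section \<open>Powers and saturations of ideals\<close>

lemma subspace_scale_right:
  "ring_ideal.subspace L \<Longrightarrow> x \<in> L \<Longrightarrow> x * c \<in> L"
  using ring_ideal.subspace_scale[of L x c] by (simp add: mult.commute)

lemma ideal_mult_mem: "x \<in> L \<Longrightarrow> y \<in> M \<Longrightarrow> x * y \<in> ideal_mult L M"
  unfolding ideal_mult_def by (rule ring_ideal.span_base) blast

lemma subspace_ideal_power: "ring_ideal.subspace (ideal_power L s)"
  by (cases s) (auto simp: ideal_mult_def)

lemma ideal_power_induct [consumes 1, case_names zero add mult]:
  assumes "x \<in> ideal_power L (Suc s)"
    and "P 0"
    and "\<And>x y. P x \<Longrightarrow> P y \<Longrightarrow> P (x + y)"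
    and "\<And>a b. a \<in> L \<Longrightarrow> b \<in> ideal_power L s \<Longrightarrow> P (a * b)"
  shows "P x"
proof -
  have "x \<in> ring_ideal.span {f * g | f g. f \<in> L \<and> g \<in> ideal_power L s}"
    using assms(1) by (simp add: ideal_mult_def)
  then show ?thesis
  proof (induction rule: ring_ideal.span_induct_alt)
    case base
    show ?case by (rule assms(2))
  next
    case (step c x y)
    then obtain a b where "x = a * b" "a \<in> L" "b \<in> ideal_power L s"
      by blast
    moreover from this have "P (a * (c * b))"
      by (intro assms(4) ring_ideal.subspace_scale subspace_ideal_power)
    ultimately have "P (c * x)"
      by (simp only: mult.left_commute)
    then show ?case
      using step.IH by (rule assms(3))
  qed
qed

lemma ideal_power_1:
  assumes "ring_ideal.subspace L"
  shows "ideal_power L (Suc 0) = L"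
proof
  show "L \<subseteq> ideal_power L (Suc 0)"
    using ideal_mult_mem[of _ L 1 UNIV] by auto
  show "ideal_power L (Suc 0) \<subseteq> L"
  proof
    fix x assume "x \<in> ideal_power L (Suc 0)"
    then show "x \<in> L"
      using assms by (induction rule: ideal_power_induct)
        (auto intro: ring_ideal.subspace_0 ring_ideal.subspace_add subspace_scale_right)
  qed
qed

lemma ideal_power_Suc_subset: "ideal_power L (Suc s) \<subseteq> ideal_power L s"
proof
  fix x assume "x \<in> ideal_power L (Suc s)"
  then show "x \<in> ideal_power L s"
    by (induction rule: ideal_power_induct)
      (auto intro: ring_ideal.subspace_0 ring_ideal.subspace_add ring_ideal.subspace_scale
        subspace_ideal_power)
qed

lemma ideal_power_mono:
  assumes "L \<subseteq> M"
  shows "ideal_power L s \<subseteq> ideal_power M s"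
proof (induction s)
  case (Suc s)
  then show ?case
    using assms unfolding ideal_power.simps ideal_mult_def
    by (intro ring_ideal.span_mono) auto
qed simp

lemma saturation_mult_power:
  assumes "ring_ideal.subspace L" "f * h ^ a \<in> L" "a \<le> b"
  shows "f * h ^ b \<in> L"
proof -
  have "f * h ^ b = h ^ (b - a) * (f * h ^ a)"
    using assms(3) by (simp add: mult_ac flip: power_add)
  then show ?thesis
    using assms ring_ideal.subspace_scale by metis
qed

lemma saturationI: "f * h ^ a \<in> L \<Longrightarrow> f \<in> saturation L h"
  by (auto simp: saturation_def)

lemma subset_saturation: "L \<subseteq> saturation L h"
  using saturationI[of _ h 0 L] by auto

lemma saturation_mono: "L \<subseteq> M \<Longrightarrow> saturation L h \<subseteq> saturation M h"
  by (auto simp: saturation_def)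

lemma subspace_saturation:
  assumes "ring_ideal.subspace L"
  shows "ring_ideal.subspace (saturation L h)"
proof (rule ring_ideal.subspaceI)
  show "0 \<in> saturation L h"
    using subset_saturation[of L h] ring_ideal.subspace_0[OF assms] by blast
next
  fix x y assume "x \<in> saturation L h" "y \<in> saturation L h"
  then obtain a b where "x * h ^ a \<in> L" "y * h ^ b \<in> L"
    by (auto simp: saturation_def)
  then have "x * h ^ (a + b) \<in> L" "y * h ^ (a + b) \<in> L"
    using saturation_mult_power[OF assms] by (meson le_add1 le_add2)+
  then have "(x + y) * h ^ (a + b) \<in> L"
    by (simp add: distrib_right ring_ideal.subspace_add[OF assms])
  then show "x + y \<in> saturation L h" by (rule saturationI)
next
  fix c x assume "x \<in> saturation L h"
  then obtain a where "x * h ^ a \<in> L"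
    by (auto simp: saturation_def)
  then have "c * x * h ^ a \<in> L"
    unfolding mult.assoc by (rule ring_ideal.subspace_scale[OF assms])
  then show "c * x \<in> saturation L h" by (rule saturationI)
qed

lemma saturation_cancel:
  assumes "ring_ideal.subspace L" "x * f \<in> saturation L h" "x dvd h ^ b"
  shows "f \<in> saturation L h"
proof -
  obtain a where a: "x * f * h ^ a \<in> L"
    using assms(2) by (auto simp: saturation_def)
  obtain w where w: "h ^ b = x * w" using assms(3) by blast
  have "f * h ^ (b + a) = w * (x * f * h ^ a)"
    unfolding power_add w by (simp only: mult_ac)
  then have "f * h ^ (b + a) \<in> L"
    using ring_ideal.subspace_scale[OF assms(1) a] by simp
  then show ?thesis by (rule saturationI)
qed

lemma ideal_power_saturation_subset:
  "ideal_power (saturation L h) s \<subseteq> saturation (ideal_power L s) h"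
proof (induction s)
  case 0
  then show ?case using subset_saturation[of UNIV h] by simp
next
  case (Suc s)
  show ?case
  proof
    fix x assume "x \<in> ideal_power (saturation L h) (Suc s)"
    then show "x \<in> saturation (ideal_power L (Suc s)) h"
    proof (induction rule: ideal_power_induct)
      case (mult x y)
      then obtain a b where "x * h ^ a \<in> L" "y * h ^ b \<in> ideal_power L s"
        using Suc by (auto simp: saturation_def)
      then have "(x * h ^ a) * (y * h ^ b) \<in> ideal_power L (Suc s)"
        unfolding ideal_power.simps by (rule ideal_mult_mem)
      then show ?case
        by (intro saturationI[of _ _ "a + b"]) (simp only: power_add mult_ac)
    qed (auto intro: ring_ideal.subspace_0 ring_ideal.subspace_add
          subspace_saturation subspace_ideal_power simp del: ideal_power.simps)
  qed
qed

section \<open>Derivations and powers of an ideal\<close>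

definition derivation :: "('a::comm_ring_1 \<Rightarrow> 'a) \<Rightarrow> bool" where
  "derivation D \<longleftrightarrow> (\<forall>x y. D (x + y) = D x + D y) \<and> (\<forall>x y. D (x * y) = x * D y + y * D x)"

lemma derivation_add: "derivation D \<Longrightarrow> D (x + y) = D x + D y"
  and derivation_mult: "derivation D \<Longrightarrow> D (x * y) = x * D y + y * D x"
  by (simp_all add: derivation_def)

lemma derivation_zero: "derivation D \<Longrightarrow> D 0 = 0"
  using derivation_add[of D 0 0] by simp

lemma derivation_one: "derivation D \<Longrightarrow> D 1 = 0"
  using derivation_mult[of D 1 1] by simp

lemma derivation_power_Suc:
  assumes "derivation D"
  shows "D (x ^ Suc a) = of_nat (Suc a) * x ^ a * D x"
proof (induction a)
  case 0
  then show ?case by (simp add: derivation_one)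
next
  case (Suc a)
  have "D (x ^ Suc (Suc a)) = x * D (x ^ Suc a) + x ^ Suc a * D x"
    by (subst power_Suc) (rule derivation_mult[OF assms])
  then show ?case by (simp only: Suc) (simp add: algebra_simps)
qed

lemma derivation_combination:
  assumes "\<And>j. j \<in> S \<Longrightarrow> derivation (D j)"
  shows "derivation (\<lambda>x. \<Sum>j\<in>S. p j * D j x)"
  using assms unfolding derivation_def
  by (simp add: distrib_left sum.distrib sum_distrib_left mult_ac)

lemma derivation_ideal_power:
  assumes "derivation D" "x \<in> ideal_power L (Suc s)"
  shows "D x \<in> ideal_power L s"
  using assms(2)
proof (induction s arbitrary: x)
  case (Suc s)
  note sub = subspace_ideal_power[of L "Suc s"]
  from Suc.prems show ?case
  proof (induction rule: ideal_power_induct)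
    case (mult a b)
    have "a * D b \<in> ideal_power L (Suc s)"
      using mult Suc.IH by (simp add: ideal_mult_mem)
    then show ?case
      unfolding derivation_mult[OF assms(1)] using mult
      by (intro ring_ideal.subspace_add[OF sub])
        (auto intro: subspace_scale_right[OF sub] simp del: ideal_power.simps)
  qed (use ring_ideal.subspace_0[OF sub] ring_ideal.subspace_add[OF sub] in
      \<open>simp_all add: derivation_zero derivation_add assms(1) del: ideal_power.simps\<close>)
qed simp

text \<open>The generator \<open>h\<close> of the saturation is not a constant of \<open>D\<close>; one extra factor \<open>h\<close> absorbs
  the term \<open>f D(h\<^bsup>a+1\<^esup>) = (a+1) f h\<^sup>a D(h)\<close> of the Leibniz rule.\<close>

lemma derivation_saturation:
  assumes "derivation D" "f \<in> saturation (ideal_power L (Suc s)) h"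
  shows "D f \<in> saturation (ideal_power L s) h"
proof -
  note sub = subspace_ideal_power[of L s]
  obtain a where a: "f * h ^ a \<in> ideal_power L (Suc s)"
    using assms(2) by (auto simp: saturation_def)
  then have "D (f * h ^ Suc a) \<in> ideal_power L s"
    by (intro derivation_ideal_power[OF assms(1)]
        saturation_mult_power[OF subspace_ideal_power _ le_SucI[OF order_refl]])
  moreover have "of_nat (Suc a) * D h * (f * h ^ a) \<in> ideal_power L s"
    using a ideal_power_Suc_subset ring_ideal.subspace_scale[OF sub] by blast
  moreover have "D f * h ^ Suc a = D (f * h ^ Suc a) - of_nat (Suc a) * D h * (f * h ^ a)"
    by (subst derivation_mult[OF assms(1)], subst derivation_power_Suc[OF assms(1)])
      (simp add: algebra_simps)
  ultimately have "D f * h ^ Suc a \<in> ideal_power L s"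
    using ring_ideal.subspace_diff[OF sub] by presburger
  then show ?thesis by (rule saturationI)
qed

text \<open>By the Leibniz rule a derivation that multiplies \<open>L\<close> by \<open>u\<close> modulo \<open>L\<^sup>2\<close> multiplies a product of \<open>s\<close>
  elements of \<open>L\<close> by \<open>s u\<close> modulo \<open>L\<^bsup>s+1\<^esup>\<close>: this is Euler's identity for forms of degree \<open>s\<close> in the
  associated graded ring.\<close>

lemma euler_ideal_power:
  assumes "derivation E" "\<And>x. x \<in> L \<Longrightarrow> E x - u * x \<in> ideal_power L 2"
    and "x \<in> ideal_power L s" "s > 0" "ring_ideal.subspace L"
  shows "E x - of_nat s * u * x \<in> ideal_power L (Suc s)"
  using assms(4,3)
proof (induction s arbitrary: x rule: nat_induct_non_zero)
  case 1
  then show ?case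
    using assms(2) ideal_power_1[OF assms(5)] by (simp add: numeral_2_eq_2 del: ideal_power.simps)
next
  case (Suc s)
  note sub = subspace_ideal_power[of L "Suc (Suc s)"]
  from Suc.prems show ?case
  proof (induction rule: ideal_power_induct)
    case zero
    then show ?case using ring_ideal.subspace_0[OF sub] by (simp add: derivation_zero assms(1))
  next
    case (add x y)
    then show ?case using ring_ideal.subspace_add[OF sub add]
      by (simp add: derivation_add assms(1) algebra_simps del: ideal_power.simps)
  next
    case (mult a b)
    have 1: "a * (E b - of_nat s * u * b) \<in> ideal_power L (Suc (Suc s))"
      using mult Suc.IH by (simp add: ideal_mult_mem)
    have "(E a - u * a) * b \<in> ideal_power L (Suc (Suc s))"
    proof -
      have "E a - u * a \<in> ideal_power L (Suc (Suc 0))"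
        using assms(2) mult by (simp add: numeral_2_eq_2 del: ideal_power.simps)
      then show ?thesis
      proof (induction rule: ideal_power_induct)
        case (mult c d)
        then have "d \<in> L" using ideal_power_1[OF assms(5)] by blast
        then have "c * (d * b) \<in> ideal_power L (Suc (Suc s))"
          using \<open>c \<in> L\<close> \<open>b \<in> ideal_power L s\<close> by (simp add: ideal_mult_mem)
        then show ?case by (simp only: mult.assoc)
      qed (use ring_ideal.subspace_0[OF sub] ring_ideal.subspace_add[OF sub] in
          \<open>simp_all add: distrib_right del: ideal_power.simps\<close>)
    qed
    from ring_ideal.subspace_add[OF sub 1 this] show ?case
      by (simp add: derivation_mult assms(1) algebra_simps del: ideal_power.simps)
  qed
qed

text \<open>Values of \<open>E\<close> in \<open>L\<close> are needed here because the Leibniz term \<open>f E(h\<^bsup>a+1\<^esup>)\<close> has to lie in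
  \<open>L\<^bsup>s+1\<^esup>\<close>, not only in \<open>L\<^sup>s\<close>.\<close>

lemma euler_saturation:
  assumes "derivation E" "\<And>x. x \<in> L \<Longrightarrow> E x - u * x \<in> ideal_power L 2"
    and "\<And>x. E x \<in> L"
    and "f \<in> saturation (ideal_power L s) h" "s > 0" "ring_ideal.subspace L"
  shows "E f - of_nat s * u * f \<in> saturation (ideal_power L (Suc s)) h"
proof -
  note sub = subspace_ideal_power[of L "Suc s"]
  obtain a where a: "f * h ^ a \<in> ideal_power L s"
    using assms(4) by (auto simp: saturation_def)
  have "f * h ^ Suc a \<in> ideal_power L s"
    by (rule saturation_mult_power[OF subspace_ideal_power a]) simp
  then have "E (f * h ^ Suc a) - of_nat s * u * (f * h ^ Suc a) \<in> ideal_power L (Suc s)"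
    using assms by (intro euler_ideal_power) auto
  moreover have "of_nat (Suc a) * (E h * (f * h ^ a)) \<in> ideal_power L (Suc s)"
    using ideal_mult_mem[OF assms(3) a] ring_ideal.subspace_scale[OF sub] by simp
  moreover have "(E f - of_nat s * u * f) * h ^ Suc a =
      (E (f * h ^ Suc a) - of_nat s * u * (f * h ^ Suc a)) - of_nat (Suc a) * (E h * (f * h ^ a))"
    by (subst derivation_mult[OF assms(1)], subst derivation_power_Suc[OF assms(1)])
      (simp add: algebra_simps)
  ultimately have "(E f - of_nat s * u * f) * h ^ Suc a \<in> ideal_power L (Suc s)"
    using ring_ideal.subspace_diff[OF sub] by presburger
  then show ?thesis by (rule saturationI)
qed

text \<open>The saturated powers of \<open>L\<close> are primary to the saturation of \<open>L\<close>. By induction on \<open>s\<close>: if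
  \<open>f g\<close> lies in the saturation of \<open>L\<^bsup>s+1\<^esup>\<close>, then \<open>f\<close> lies in that of \<open>L\<^sup>s\<close>, and differentiating \<open>f g\<close> puts
  \<open>g D\<^sub>j f\<close>, hence \<open>D\<^sub>j f\<close>, in that of \<open>L\<^sup>s\<close> too. So \<open>E f = \<Sum>\<^sub>j p\<^sub>j D\<^sub>j f\<close> lies in that of \<open>L\<^bsup>s+1\<^esup>\<close>; modulo
  it, \<open>E f\<close> equals \<open>s u f\<close>, and \<open>s\<close> and \<open>u\<close> can be cancelled. The hypothesis on \<open>E\<close> replaces the
  usual assumption that \<open>L\<close> is generated by a regular sequence after inverting \<open>h\<close>.\<close>

theorem saturation_power_cancel:
  fixes L :: "'a::comm_ring_1 set" and p :: "'b \<Rightarrow> 'a"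
  assumes L: "ring_ideal.subspace L"
    and prime: "\<And>f g. f * g \<in> saturation L h \<Longrightarrow> f \<in> saturation L h \<or> g \<in> saturation L h"
    and D: "\<And>j. j \<in> S \<Longrightarrow> derivation (D j)"
    and p: "\<And>j. j \<in> S \<Longrightarrow> p j \<in> L"
    and euler: "\<And>x. x \<in> L \<Longrightarrow> (\<Sum>j\<in>S. p j * D j x) - u * x \<in> ideal_power L 2"
    and u: "u dvd h ^ b"
    and char0: "\<And>s. s > 0 \<Longrightarrow> (of_nat s :: 'a) dvd 1"
    and g: "g \<notin> saturation L h"
    and fg: "f * g \<in> saturation (ideal_power L s) h"
  shows "f \<in> saturation (ideal_power L s) h"
  using fg
proof (induction s arbitrary: f)
  case 0
  then show ?case using subset_saturation[of UNIV h] by auto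
next
  case (Suc s)
  note sub = subspace_saturation[where L = "ideal_power L r" and h = h for r, OF subspace_ideal_power]
  define E where "E x = (\<Sum>j\<in>S. p j * D j x)" for x
  have fs: "f \<in> saturation (ideal_power L s) h"
    using Suc saturation_mono[OF ideal_power_Suc_subset[of L s]] by blast
  show ?case
  proof (cases "s = 0")
    case True
    then show ?thesis
      using Suc.prems prime g ideal_power_1[OF L] by (auto simp del: ideal_power.simps)
  next
    case False
    have "p j * D j f \<in> saturation (ideal_power L (Suc s)) h" if j: "j \<in> S" for j
    proof -
      have "D j (f * g) - D j g * f \<in> saturation (ideal_power L s) h"
        by (rule ring_ideal.subspace_diff[OF sub derivation_saturation[OF D[OF j] Suc.prems]
              ring_ideal.subspace_scale[OF sub fs]])
      then have "D j f * g \<in> saturation (ideal_power L s) h"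
        by (simp add: derivation_mult[OF D[OF j]] algebra_simps)
      then obtain a where "D j f * h ^ a \<in> ideal_power L s"
        using Suc.IH by (auto simp: saturation_def)
      then have "p j * (D j f * h ^ a) \<in> ideal_power L (Suc s)"
        using p[OF j] by (simp add: ideal_mult_mem)
      then show ?thesis
        by (intro saturationI[of _ _ a]) (simp only: mult.assoc)
    qed
    then have Ef: "E f \<in> saturation (ideal_power L (Suc s)) h"
      unfolding E_def by (rule ring_ideal.subspace_sum[OF sub])
    have derE: "derivation E"
      unfolding E_def using derivation_combination[of S D p] D by simp
    have EL: "E x \<in> L" for x
      unfolding E_def using p
      by (intro ring_ideal.subspace_sum[OF L]) (auto intro: subspace_scale_right[OF L])
    have "E f - of_nat s * u * f \<in> saturation (ideal_power L (Suc s)) h"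
      using False euler by (intro euler_saturation derE EL fs L) (auto simp: E_def)
    from ring_ideal.subspace_diff[OF sub Ef this]
    have *: "of_nat s * u * f \<in> saturation (ideal_power L (Suc s)) h"
      by simp
    obtain c :: 'a where "1 = of_nat s * c"
      using char0[of s] False unfolding dvd_def by blast
    then have "u * f = c * (of_nat s * u * f)"
      by (metis mult.assoc mult.commute mult_1)
    then have "u * f \<in> saturation (ideal_power L (Suc s)) h"
      using ring_ideal.subspace_scale[OF sub *] by metis
    then show ?thesis
      using saturation_cancel[OF subspace_ideal_power _ u] by blast
  qed
qed

section \<open>Linear extension of maps between exponents\<close>

text \<open>For an additive map \<open>h\<close> this is the induced homomorphism of monoid algebras. It serves with
  exponent vectors as the monoid, with exponent vectors themselves as functions on the variables, and
  with a map of exponents that is not additive.\<close>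

definition push :: "('a \<Rightarrow> 'b) \<Rightarrow> ('a \<Rightarrow>\<^sub>0 'c::comm_monoid_add) \<Rightarrow> ('b \<Rightarrow>\<^sub>0 'c)" where
  "push h f = (\<Sum>a\<in>Poly_Mapping.keys f. Poly_Mapping.single (h a) (Poly_Mapping.lookup f a))"

lemma poly_mapping_sum_singles:
  fixes f :: "'a \<Rightarrow>\<^sub>0 'b::comm_monoid_add"
  shows "f = (\<Sum>a\<in>Poly_Mapping.keys f. Poly_Mapping.single a (Poly_Mapping.lookup f a))"
  by (rule poly_mapping_eqI)
     (simp add: lookup_sum lookup_single when_def sum.delta in_keys_iff)

lemma poly_mapping_single_induct [case_names single add]:
  fixes f :: "'a \<Rightarrow>\<^sub>0 'b::comm_monoid_add"
  assumes single: "\<And>a c. P (Poly_Mapping.single a c)"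
    and add: "\<And>f g. P f \<Longrightarrow> P g \<Longrightarrow> P (f + g)"
  shows "P f"
proof -
  have "P 0" using single[of undefined 0] by simp
  then have "P (\<Sum>a\<in>S. Poly_Mapping.single a (Poly_Mapping.lookup f a))" for S
    by (induction S rule: infinite_finite_induct) (simp_all add: single add)
  then show ?thesis using poly_mapping_sum_singles[of f] by metis
qed

lemma push_superset:
  assumes "finite S" "Poly_Mapping.keys f \<subseteq> S"
  shows "push h f = (\<Sum>a\<in>S. Poly_Mapping.single (h a) (Poly_Mapping.lookup f a))"
  unfolding push_def using assms by (intro sum.mono_neutral_left) (auto simp: in_keys_iff)

lemma push_single: "push h (Poly_Mapping.single a c) = Poly_Mapping.single (h a) c"
  by (subst push_superset[of "{a}"]) auto

lemma push_zero [simp]: "push h 0 = 0"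
  by (simp add: push_def)

lemma push_add: "push h (f + g) = push h f + push h g"
  by (subst (1 2 3) push_superset[of "Poly_Mapping.keys f \<union> Poly_Mapping.keys g"])
     (use Poly_Mapping.keys_add[of f g] in
       \<open>auto simp: lookup_add single_add sum.distrib\<close>)

lemma push_push: "push g (push h f) = push (\<lambda>a. g (h a)) f"
  by (induction f rule: poly_mapping_single_induct) (simp_all add: push_single push_add)

lemma push_mult:
  fixes f g :: "'a::comm_monoid_add \<Rightarrow>\<^sub>0 'c::comm_ring_1"
    and h :: "'a \<Rightarrow> 'b::comm_monoid_add"
  assumes "\<And>a b. h (a + b) = h a + h b"
  shows "push h (f * g) = push h f * push h g"
proof (induction f rule: poly_mapping_single_induct)
  case (single a c)
  show ?case
    by (induction g rule: poly_mapping_single_induct)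
      (simp_all add: mult_single push_single push_add distrib_left assms)
qed (simp add: push_add distrib_right)

lemma lookup_push_inj:
  assumes "inj h"
  shows "Poly_Mapping.lookup (push h f) (h a) = Poly_Mapping.lookup f a"
  by (induction f rule: poly_mapping_single_induct)
    (simp_all add: push_single push_add lookup_add lookup_single when_def inj_eq[OF assms])

lemma inj_push: "inj h \<Longrightarrow> inj (push h)"
  by (rule injI, rule poly_mapping_eqI) (metis lookup_push_inj)

text \<open>Polynomials over ordered variables form an integral domain; an injection of the finitely
  many variables into the natural numbers transports this to an index type without an order.\<close>

lemma mvpoly_no_zero_divisors:
  fixes f g :: "('n::finite, 'k::idom) mvpoly"
  assumes "f * g = 0"
  shows "f = 0 \<or> g = 0"
proof -
  define h :: "('n \<Rightarrow>\<^sub>0 nat) \<Rightarrow> (nat \<Rightarrow>\<^sub>0 nat)" where "h = push to_nat"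
  have inj: "inj h" unfolding h_def by (intro inj_push inj_to_nat)
  have "push h f * push h g = push h (f * g)"
    by (rule push_mult[symmetric]) (simp add: h_def push_add)
  then have "push h f = 0 \<or> push h g = 0"
    using assms by simp
  then show ?thesis
    using inj_push[OF inj] by (auto dest: injD[of _ _ 0])
qed

section \<open>Monomials\<close>

definition expo :: "nat ^ 'n::finite \<Rightarrow> ('n \<Rightarrow>\<^sub>0 nat)" where
  "expo \<alpha> = (\<Sum>i\<in>UNIV. Poly_Mapping.single i (\<alpha> $ i))"

lemma lookup_expo [simp]: "Poly_Mapping.lookup (expo \<alpha>) i = \<alpha> $ i"
  by (simp add: expo_def lookup_sum lookup_single when_def)

lemma expo_lookup: "expo (\<chi> i. Poly_Mapping.lookup a i) = a"
  by (rule poly_mapping_eqI) simp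

lemma mvMonom_eq_single: "mvMonom \<alpha> = Poly_Mapping.single (expo \<alpha>) 1"
proof -
  have pow: "mvVar i ^ k = Poly_Mapping.single (Poly_Mapping.single i k) 1" for i k
    by (induction k) (simp_all add: mvVar_def mult_single flip: single_add)
  have "(\<Prod>i\<in>S. Poly_Mapping.single (Poly_Mapping.single i (\<alpha> $ i)) 1)
      = Poly_Mapping.single (\<Sum>i\<in>S. Poly_Mapping.single i (\<alpha> $ i)) (1::'b)" if "finite S" for S
    using that by induction (simp_all add: mult_single)
  then show ?thesis by (simp add: mvMonom_def expo_def pow)
qed

lemma mvMonom_dvd_power:
  "\<exists>b. mvMonom \<alpha> dvd (\<Prod>i\<in>UNIV. mvVar i :: ('n::finite, 'k::comm_ring_1) mvpoly) ^ b"
proof -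
  define b where "b = (\<Sum>i\<in>UNIV. \<alpha> $ i)"
  have "(\<Prod>i\<in>UNIV. mvVar i ^ (\<alpha> $ i) :: ('n, 'k) mvpoly) dvd (\<Prod>i\<in>UNIV. mvVar i ^ b)"
    unfolding b_def by (intro prod_dvd_prod le_imp_power_dvd member_le_sum) auto
  then show ?thesis by (auto simp: mvMonom_def prod_power_distrib)
qed

section \<open>Toric ideals\<close>

text \<open>The toric map sends \<open>e\<^sup>a\<close> to \<open>x\<^bsup>A a\<^esup>\<close>, so that \<open>toric_degree A\<close> is multiplication
  by \<open>A\<close> on exponents.\<close>

definition toric_degree :: "nat ^ 'n::finite ^ 'm::finite \<Rightarrow> ('n \<Rightarrow>\<^sub>0 nat) \<Rightarrow> ('m \<Rightarrow>\<^sub>0 nat)" where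
  "toric_degree A a = expo (\<chi> j. \<Sum>i\<in>UNIV. A $ j $ i * Poly_Mapping.lookup a i)"

lemma toric_map_eq_push:
  fixes A :: "nat ^ 'n::finite ^ 'm::finite" and f :: "('n, 'k::comm_ring_1) mvpoly"
  shows "toric_map A f = push (toric_degree A) f"
proof (induction f rule: poly_mapping_single_induct)
  case (single a c)
  have "(\<Prod>i\<in>UNIV. mvMonom (column i A) ^ Poly_Mapping.lookup a i) =
      (\<Prod>i\<in>UNIV. \<Prod>j\<in>UNIV. mvVar j ^ (A $ j $ i * Poly_Mapping.lookup a i) :: ('m, 'k) mvpoly)"
    by (simp add: mvMonom_def column_def power_mult flip: prod_power_distrib)
  also have "\<dots> = (\<Prod>j\<in>UNIV. \<Prod>i\<in>UNIV. mvVar j ^ (A $ j $ i * Poly_Mapping.lookup a i))"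
    by (rule prod.swap)
  also have "\<dots> = Poly_Mapping.single (toric_degree A a) 1"
    by (simp add: toric_degree_def mvMonom_def power_sum flip: mvMonom_eq_single)
  finally show ?case
    by (simp add: toric_map_single push_single mvConst_def mult_single)
qed (simp add: push_add toric_map_add)

lemma toric_ideal_subspace: "ring_ideal.subspace (toric_ideal A)"
  by (rule ring_ideal.subspaceI) (simp_all add: toric_ideal_def toric_map_add toric_map_mult)

lemma toric_ideal_prime:
  fixes f g :: "('n::finite, 'k::idom) mvpoly"
  assumes "f * g \<in> toric_ideal A"
  shows "f \<in> toric_ideal A \<or> g \<in> toric_ideal A"
  using assms mvpoly_no_zero_divisors by (auto simp: toric_ideal_def toric_map_mult)

lemma mvMonom_notin_toric_ideal:
  "(mvMonom \<alpha> :: ('n::finite, 'k::idom) mvpoly) \<notin> toric_ideal A"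
proof -
  have "toric_map A (mvMonom \<alpha> :: ('n, 'k) mvpoly) =
      Poly_Mapping.single (toric_degree A (expo \<alpha>)) 1"
    by (simp add: toric_map_eq_push mvMonom_eq_single push_single)
  moreover have "\<dots> \<noteq> 0"
    by (metis lookup_single_eq lookup_zero zero_neq_one)
  ultimately show ?thesis by (simp add: toric_ideal_def)
qed

section \<open>Binomials of a lattice\<close>

definition exponent_diff :: "('n::finite \<Rightarrow>\<^sub>0 nat) \<Rightarrow> ('n \<Rightarrow>\<^sub>0 nat) \<Rightarrow> int ^ 'n" where
  "exponent_diff a b = (\<chi> i. int (Poly_Mapping.lookup a i) - int (Poly_Mapping.lookup b i))"

lemma exponent_diff_in_matrix_kernel:
  "exponent_diff a b \<in> matrix_kernel A \<longleftrightarrow> toric_degree A a = toric_degree A b"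
proof -
  have "(map_matrix int A *v exponent_diff a b) $ j =
      int (Poly_Mapping.lookup (toric_degree A a) j) - int (Poly_Mapping.lookup (toric_degree A b) j)"
    for j
    by (simp add: matrix_vector_mult_def map_matrix_def exponent_diff_def toric_degree_def
        right_diff_distrib sum_subtractf)
  then show ?thesis
    by (auto simp: matrix_kernel_def vec_eq_iff poly_mapping_eq_iff fun_eq_iff)
qed

lemma exponent_diff_pos_neg: "exponent_diff (expo (vec_pos u)) (expo (vec_neg u)) = u"
  by (simp add: exponent_diff_def vec_pos_def vec_neg_def vec_eq_iff)

lemma lattice_binomial_eq:
  "lattice_binomial u = Poly_Mapping.single (expo (vec_pos u)) 1 - Poly_Mapping.single (expo (vec_neg u)) 1"
  by (simp add: lattice_binomial_def mvMonom_eq_single)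

lemma lattice_binomial_in_toric_ideal:
  assumes "u \<in> matrix_kernel A"
  shows "lattice_binomial u \<in> toric_ideal A"
proof -
  have "toric_map A (Poly_Mapping.single (expo (vec_pos u)) 1) =
      toric_map A (Poly_Mapping.single (expo (vec_neg u)) 1)"
    using exponent_diff_in_matrix_kernel[of "expo (vec_pos u)" "expo (vec_neg u)" A] assms
    by (simp add: toric_map_eq_push push_single exponent_diff_pos_neg)
  then show ?thesis
    unfolding toric_ideal_def lattice_binomial_eq mem_Collect_eq
    by (metis add_diff_cancel_right' diff_add_cancel toric_map_add right_minus_eq)
qed

section \<open>Dual functionals\<close>

definition rat_vec :: "int ^ 'n \<Rightarrow> rat ^ 'n" where
  "rat_vec u = (\<chi> i. of_int (u $ i))"

text \<open>Clearing denominators turns a rational relation into an integral one.\<close>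

lemma rational_independent:
  fixes C :: "(int ^ 'n::finite) set"
  assumes "int_lattice.independent C"
  shows "vec.independent (rat_vec ` C)"
proof
  let ?r = "rat_vec"
  have inj: "inj ?r" by (auto simp: inj_def vec_eq_iff rat_vec_def)
  assume "vec.dependent (?r ` C)"
  then obtain T c where T: "finite T" "T \<subseteq> ?r ` C" "(\<Sum>v\<in>T. c v *s v) = 0" "\<exists>v\<in>T. c v \<noteq> 0"
    unfolding vec.dependent_explicit by blast
  obtain S where S: "S \<subseteq> C" "T = ?r ` S" using T(2) by (meson subset_imageE)
  have finS: "finite S" using T(1) S(2) inj by (metis finite_imageD inj_on_subset subset_UNIV)
  \<comment> \<open>A common denominator of the coefficients.\<close>
  define d where "d = (\<Prod>v\<in>S. snd (quotient_of (c (?r v))))"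
  have d: "d > 0" unfolding d_def by (intro prod_pos) (simp add: quotient_of_denom_pos')
  have "\<exists>k. of_int k = of_int d * c (?r v)" if v: "v \<in> S" for v
  proof -
    obtain p q where pq: "quotient_of (c (?r v)) = (p, q)" by force
    have q: "q > 0" using quotient_of_denom_pos[OF pq] .
    have "q dvd d" unfolding d_def using dvd_prodI[OF finS v, of "\<lambda>v. snd (quotient_of (c (?r v)))"] pq by simp
    then obtain e where "d = q * e" by blast
    then have "of_int (e * p) = of_int d * c (?r v)"
      using quotient_of_div[OF pq] q by simp
    then show ?thesis by blast
  qed
  then obtain k where k: "\<And>v. v \<in> S \<Longrightarrow> of_int (k v) = of_int d * c (?r v)" by metis
  have "(\<Sum>v\<in>S. k v *s v) = 0"
  proof (rule vec_eq_iff[THEN iffD2, rule_format])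
    fix i
    have "rat_of_int ((\<Sum>v\<in>S. k v *s v) $ i) = (\<Sum>v\<in>S. of_int (k v) * of_int (v $ i))"
      by simp
    also have "\<dots> = of_int d * (\<Sum>v\<in>S. c (?r v) * of_int (v $ i))"
      by (simp add: k sum_distrib_left mult.assoc)
    also have "(\<Sum>v\<in>S. c (?r v) * of_int (v $ i)) = (\<Sum>v\<in>T. c v *s v) $ i"
      unfolding S(2) using inj
      by (subst sum.reindex) (auto simp: rat_vec_def intro: inj_on_subset)
    finally have "rat_of_int ((\<Sum>v\<in>S. k v *s v) $ i) = 0"
      unfolding T(3) by (simp only: zero_index mult_zero_right)
    then show "(\<Sum>v\<in>S. k v *s v) $ i = (0 :: int ^ 'n) $ i"
      by (simp only: of_int_eq_0_iff zero_index)
  qed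
  then have "k v = 0" if "v \<in> S" for v
    using int_lattice.independentD[OF assms finS S(1)] that by blast
  then show False using T(4) S(2) k d by fastforce
qed

text \<open>Only the values on the lattice basis matter, so the functionals are coordinates with respect to
  any extension of it to a basis of the rational vector space. In general they are not integral on
  the whole of \<open>\<int>\<^sup>n\<close>: they take values in the prime field.\<close>

lemma dual_functionals:
  fixes C :: "(int ^ 'n::finite) set"
  assumes "int_lattice.independent C"
  obtains l :: "int ^ 'n \<Rightarrow> int ^ 'n \<Rightarrow> 'k::field_char_0" where
    "finite C" "\<And>v x y. l v (x + y) = l v x + l v y"
    "\<And>v w. v \<in> C \<Longrightarrow> w \<in> C \<Longrightarrow> l v w = (if v = w then 1 else 0)"
proof -
  let ?r = "rat_vec :: int ^ 'n \<Rightarrow> _"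
  have inj: "inj ?r" by (auto simp: inj_def vec_eq_iff rat_vec_def)
  note ind = rational_independent[OF assms]
  have fin: "finite C"
    using vec.finiteI_independent[OF ind] inj by (metis finite_imageD inj_on_subset subset_UNIV)
  let ?B = "vec.extend_basis (?r ` C)"
  note B = vec.independent_extend_basis[OF ind] vec.span_extend_basis[OF ind]
    vec.extend_basis_superset[OF ind]
  define l where "l v x = (of_rat (vec.representation ?B (?r x) (?r v)) :: 'k)" for v x
  show ?thesis
  proof (rule that[of l])
    fix v x y
    have "?r (x + y) = ?r x + ?r y" by (simp add: rat_vec_def vec_eq_iff)
    then show "l v (x + y) = l v x + l v y"
      using B by (simp add: l_def vec.representation_add of_rat_add)
  next
    fix v w assume "v \<in> C" "w \<in> C"
    then have "?r w \<in> ?B" using B by blast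
    then show "l v w = (if v = w then 1 else 0)"
      using B inj by (auto simp: l_def vec.representation_basis inj_eq)
  qed (rule fin)
qed


section \<open>Euler derivations\<close>

text \<open>For a weight \<open>l\<close> that is additive on exponents this is \<open>\<Sum>\<^sub>i l(e\<^sub>i) e\<^sub>i \<partial>/\<partial>e\<^sub>i\<close>.\<close>

lift_definition euler_derivation ::
    "('a \<Rightarrow> 'k) \<Rightarrow> ('a \<Rightarrow>\<^sub>0 'k) \<Rightarrow> ('a \<Rightarrow>\<^sub>0 'k::comm_ring_1)"
  is "\<lambda>l f a. l a * f a"
  by (erule finite_subset[rotated]) auto

lemma euler_derivation_single:
  "euler_derivation l (Poly_Mapping.single a c) = Poly_Mapping.single a (l a * c)"
  by transfer (auto simp: when_def fun_eq_iff)

lemma euler_derivation_add: "euler_derivation l (f + g) = euler_derivation l f + euler_derivation l g"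
  by transfer (simp add: distrib_left)

lemma derivation_euler_derivation:
  fixes l :: "'a::comm_monoid_add \<Rightarrow> 'k::comm_ring_1"
  assumes "\<And>a b. l (a + b) = l a + l b"
  shows "derivation (euler_derivation l)"
proof -
  have "euler_derivation l (f * g) = f * euler_derivation l g + g * euler_derivation l f" for f g
  proof (induction f rule: poly_mapping_single_induct)
    case (single a c)
    show ?case
    proof (induction g rule: poly_mapping_single_induct)
      case (single b d)
      show ?case
        by (simp add: mult_single euler_derivation_single assms add.commute[of b]
            algebra_simps flip: single_add)
    qed (simp add: euler_derivation_add algebra_simps)
  qed (simp add: euler_derivation_add algebra_simps)
  then show ?thesis by (simp add: derivation_def euler_derivation_add)
qed

section \<open>The toric ideal as a saturation\<close>

lemma saturation_mvMonom_cancel: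
  fixes L :: "('n::finite, 'k::comm_ring_1) mvpoly set"
  assumes "ring_ideal.subspace L"
    and "Poly_Mapping.single a 1 * f \<in> saturation L (\<Prod>i\<in>UNIV. mvVar i)"
  shows "f \<in> saturation L (\<Prod>i\<in>UNIV. mvVar i)"
proof -
  have "Poly_Mapping.single a 1 = (mvMonom (\<chi> i. Poly_Mapping.lookup a i) :: ('n, 'k) mvpoly)"
    by (simp add: mvMonom_eq_single expo_lookup)
  then show ?thesis
    using saturation_cancel[OF assms] mvMonom_dvd_power by metis
qed

text \<open>The vectors \<open>u\<close> for which every binomial \<open>e\<^sup>a - e\<^sup>b\<close> with \<open>a - b = u\<close> lies in a saturated ideal form
  a subgroup of \<open>\<int>\<^sup>n\<close>: a sum is treated by telescoping through an intermediate monomial, which exists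
  after multiplication by a monomial that makes its exponent nonnegative.\<close>

lemma lattice_difference_in_saturation:
  fixes C :: "(int ^ 'n::finite) set"
  assumes "exponent_diff a b \<in> int_lattice.span C"
  shows "Poly_Mapping.single a 1 - Poly_Mapping.single b 1 \<in> saturation
    (ring_ideal.span (lattice_binomial ` C :: ('n, 'k::comm_ring_1) mvpoly set)) (\<Prod>i\<in>UNIV. mvVar i)"
proof -
  define J where "J = ring_ideal.span (lattice_binomial ` C :: ('n, 'k) mvpoly set)"
  define Q where "Q = saturation J (\<Prod>i\<in>UNIV. mvVar i)"
  have J: "ring_ideal.subspace J" by (simp add: J_def)
  have Q: "ring_ideal.subspace Q" by (simp add: Q_def subspace_saturation J)
  define P where "P u \<longleftrightarrow> (\<forall>a b. exponent_diff a b = u \<longrightarrow>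
    Poly_Mapping.single a 1 - Poly_Mapping.single b 1 \<in> Q)" for u
  have P0: "P 0"
    unfolding P_def
  proof (intro allI impI)
    fix a b :: "'n \<Rightarrow>\<^sub>0 nat" assume "exponent_diff a b = 0"
    then have "a = b" by (simp add: exponent_diff_def vec_eq_iff poly_mapping_eqI)
    then show "Poly_Mapping.single a 1 - Poly_Mapping.single b 1 \<in> Q"
      using ring_ideal.subspace_0[OF Q] by simp
  qed
  have Puminus: "P (- u)" if "P u" for u
    unfolding P_def
  proof (intro allI impI)
    fix a b :: "'n \<Rightarrow>\<^sub>0 nat" assume ab: "exponent_diff a b = - u"
    have "exponent_diff b a $ i = u $ i" for i
      using ab[unfolded vec_eq_iff, rule_format, of i] by (simp add: exponent_diff_def)
    then have "exponent_diff b a = u"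
      by (simp add: vec_eq_iff)
    then show "Poly_Mapping.single a 1 - Poly_Mapping.single b 1 \<in> Q"
      using that ring_ideal.subspace_neg[OF Q] unfolding P_def by fastforce
  qed
  have Padd: "P (u + w)" if "P u" "P w" for u w
    unfolding P_def
  proof (intro allI impI)
    fix a b :: "'n \<Rightarrow>\<^sub>0 nat" assume ab: "exponent_diff a b = u + w"
    \<comment> \<open>The intermediate monomial has exponent \<open>d = (b + c) + w\<close>, where adding \<open>c = w\<^sup>-\<close> keeps it nonnegative.\<close>
    define c where "c = expo (vec_neg w)"
    define d where "d = b + expo (vec_pos w)"
    have "exponent_diff (a + c) d $ i = u $ i" "exponent_diff d (b + c) $ i = w $ i" for i
      using ab[unfolded vec_eq_iff, rule_format, of i]
      by (auto simp: exponent_diff_def c_def d_def lookup_add vec_pos_def vec_neg_def)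
    then have "exponent_diff (a + c) d = u" "exponent_diff d (b + c) = w"
      by (simp_all add: vec_eq_iff)
    then have "Poly_Mapping.single (a + c) 1 - Poly_Mapping.single d 1 \<in> Q"
      "Poly_Mapping.single d 1 - Poly_Mapping.single (b + c) 1 \<in> Q"
      using that by (auto simp: P_def)
    from ring_ideal.subspace_add[OF Q this]
    have "Poly_Mapping.single c 1 * (Poly_Mapping.single a 1 - Poly_Mapping.single b 1) \<in> Q"
      by (simp add: right_diff_distrib mult_single add.commute)
    then show "Poly_Mapping.single a 1 - Poly_Mapping.single b 1 \<in> Q"
      unfolding Q_def by (rule saturation_mvMonom_cancel[OF J])
  qed
  have PC: "P v" if v: "v \<in> C" for v
    unfolding P_def
  proof (intro allI impI)
    fix a b :: "'n \<Rightarrow>\<^sub>0 nat" assume ab: "exponent_diff a b = v"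
    define c where "c = a - expo (vec_pos v)"
    have "Poly_Mapping.lookup a i = Poly_Mapping.lookup (c + expo (vec_pos v)) i \<and>
        Poly_Mapping.lookup b i = Poly_Mapping.lookup (c + expo (vec_neg v)) i" for i
      using ab[unfolded vec_eq_iff, rule_format, of i]
      by (auto simp: exponent_diff_def c_def lookup_add lookup_minus vec_pos_def vec_neg_def)
    then have "a = c + expo (vec_pos v)" "b = c + expo (vec_neg v)"
      by (auto intro: poly_mapping_eqI)
    then have "Poly_Mapping.single a 1 - Poly_Mapping.single b 1 =
        Poly_Mapping.single c 1 * (lattice_binomial v :: ('n, 'k) mvpoly)"
      by (simp add: lattice_binomial_eq right_diff_distrib mult_single)
    moreover have "lattice_binomial v \<in> J"
      unfolding J_def using v by (intro ring_ideal.span_base) blast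
    ultimately show "Poly_Mapping.single a 1 - Poly_Mapping.single b 1 \<in> Q"
      using ring_ideal.subspace_scale[OF J] subset_saturation[of J] unfolding Q_def by force
  qed
  have Pscale: "P (k *s v)" if "P v" for k v
  proof (induction k rule: int_induct[where k = 0])
    case base
    then show ?case using P0 by simp
  next
    case (step1 k)
    then show ?case using Padd[OF step1(2) that] by (simp add: int_lattice.scale_left_distrib)
  next
    case (step2 k)
    have "(k - 1) *s v = k *s v + - v"
      by (simp add: vec_eq_iff algebra_simps)
    then show ?case using Padd[OF step2(2) Puminus[OF that]] by simp
  qed
  have "P (exponent_diff a b)"
    using assms by (induction rule: int_lattice.span_induct_alt) (auto intro: P0 Padd Pscale PC)
  then show ?thesis
    by (auto simp: P_def Q_def J_def)
qed

text \<open>Replacing each monomial by a fixed representative of its toric degree changes \<open>f\<close> only by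
  binomials of the lattice. The result depends on \<open>f\<close> only through its image under the toric map, which
  is zero.\<close>

theorem toric_ideal_subset_saturation:
  fixes A :: "nat ^ 'n::finite ^ 'm::finite"
  assumes C: "int_lattice.span C = matrix_kernel A"
  shows "(toric_ideal A :: ('n, 'k::comm_ring_1) mvpoly set)
    \<subseteq> saturation (ring_ideal.span (lattice_binomial ` C)) (\<Prod>i\<in>UNIV. mvVar i)" (is "_ \<subseteq> ?Q")
proof
  fix f :: "('n, 'k) mvpoly" assume "f \<in> toric_ideal A"
  then have f0: "push (toric_degree A) f = 0"
    by (simp add: toric_ideal_def toric_map_eq_push)
  have Q: "ring_ideal.subspace ?Q"
    by (simp add: subspace_saturation)
  define \<rho> where "\<rho> c = (SOME b. toric_degree A b = c)" for c
  define r where "r a = \<rho> (toric_degree A a)" for a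
  have r: "toric_degree A (r a) = toric_degree A a" for a
    unfolding r_def \<rho>_def by (rule someI) (rule refl)
  have "push r f = push \<rho> (push (toric_degree A) f)"
    by (simp add: push_push r_def[abs_def])
  then have "push r f = 0" by (simp add: f0)
  moreover have "f - push r f \<in> ?Q"
  proof (induction f rule: poly_mapping_single_induct)
    case (single a c)
    have "exponent_diff a (r a) \<in> int_lattice.span C"
      by (simp add: C exponent_diff_in_matrix_kernel r)
    from ring_ideal.subspace_scale[OF Q lattice_difference_in_saturation[OF this]]
    have "mvConst c * (Poly_Mapping.single a 1 - Poly_Mapping.single (r a) 1) \<in> ?Q" .
    then show ?case
      by (simp add: push_single mvConst_def right_diff_distrib mult_single)
  next
    case (add f g)
    from ring_ideal.subspace_add[OF Q this] show ?case
      by (simp add: push_add algebra_simps)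
  qed
  ultimately show "f \<in> ?Q" by simp
qed

section \<open>Symbolic powers of toric ideals\<close>

lemma euler_lattice_binomial:
  fixes l :: "('n::finite \<Rightarrow>\<^sub>0 nat) \<Rightarrow> 'k::comm_ring_1"
  shows "euler_derivation l (lattice_binomial u) =
    mvConst (l (expo (vec_pos u)) - l (expo (vec_neg u))) * mvMonom (vec_pos u)
      + mvConst (l (expo (vec_neg u))) * lattice_binomial u"
proof -
  have "euler_derivation l (Poly_Mapping.single a 1 - Poly_Mapping.single b 1) =
      Poly_Mapping.single a (l a) - Poly_Mapping.single b (l b)" for a b
    by (metis (no_types) add_diff_cancel_right' diff_add_cancel euler_derivation_add
        euler_derivation_single mult.right_neutral)
  then show ?thesis
    by (simp add: lattice_binomial_eq mvMonom_eq_single mvConst_def right_diff_distrib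
        left_diff_distrib mult_single single_diff)
qed

text \<open>In the Laurent ring, with \<open>y\<^sub>v = e\<^sup>v\<close> for \<open>v\<close> in \<open>C\<close>, the ideal \<open>J\<close> is generated by the \<open>y\<^sub>v - 1\<close>, and
  derivations with \<open>D\<^sub>v y\<^sub>w = \<delta>\<^bsub>vw\<^esub> y\<^sub>w\<close> come from functionals dual to \<open>C\<close>. The derivation
  \<open>\<Sum>\<^sub>v (1 - y\<^sub>v\<^sup>-\<^sup>1) D\<^sub>v\<close> fixes every \<open>y\<^sub>w - 1\<close>, hence it is the identity on \<open>J\<close> modulo \<open>J\<^sup>2\<close>. Multiplying it
  by the common denominator \<open>u\<close> of the \<open>y\<^sub>v\<^sup>-\<^sup>1\<close> makes its coefficients polynomials.\<close>

lemma lattice_ideal_euler: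
  fixes C :: "(int ^ 'n::finite) set"
    and J :: "('n, 'k::field_char_0) mvpoly set"
  assumes "int_lattice.independent C" and J: "J = ring_ideal.span (lattice_binomial ` C)"
  obtains D :: "int ^ 'n \<Rightarrow> ('n, 'k) mvpoly \<Rightarrow> ('n, 'k) mvpoly" and p u b where
    "\<And>v. derivation (D v)" "\<And>v. v \<in> C \<Longrightarrow> p v \<in> J"
    "\<And>x. x \<in> J \<Longrightarrow> (\<Sum>v\<in>C. p v * D v x) - u * x \<in> ideal_power J 2"
    "u dvd (\<Prod>i\<in>UNIV. mvVar i) ^ b"
proof -
  have subJ: "ring_ideal.subspace J" by (simp add: J)
  note sub = subspace_ideal_power[of J 2]
  have J2: "ideal_power J 2 = ideal_mult J J"
    using ideal_power_1[OF subJ] by (simp add: numeral_2_eq_2)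
  let ?f = "lattice_binomial :: int ^ 'n \<Rightarrow> ('n, 'k) mvpoly"
  have fJ: "?f v \<in> J" if "v \<in> C" for v
    unfolding J using that by (intro ring_ideal.span_base) blast
  obtain l :: "int ^ 'n \<Rightarrow> int ^ 'n \<Rightarrow> 'k" where
    fin: "finite C" and ladd: "\<And>v x y. l v (x + y) = l v x + l v y"
    and dual: "\<And>v w. v \<in> C \<Longrightarrow> w \<in> C \<Longrightarrow> l v w = (if v = w then 1 else 0)"
    using dual_functionals[OF assms(1)] by metis
  define deg where "deg v a = l v (\<chi> i. int (Poly_Mapping.lookup a i))" for v a
  define D where "D v = euler_derivation (deg v)" for v
  \<comment> \<open>This is \<open>u (1 - y\<^sub>v\<^sup>-\<^sup>1)\<close>, written without division.\<close>
  define p where "p v = ?f v * (\<Prod>w\<in>C - {v}. mvMonom (vec_pos w))" for v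
  define u :: "('n, 'k) mvpoly" where "u = (\<Prod>v\<in>C. mvMonom (vec_pos v))"
  have der: "derivation (D v)" for v
  proof -
    have "(\<chi> i. int (Poly_Mapping.lookup (a + b) i)) =
        (\<chi> i. int (Poly_Mapping.lookup a i)) + (\<chi> i. int (Poly_Mapping.lookup b i))"
      for a b :: "'n \<Rightarrow>\<^sub>0 nat"
      by (simp add: vec_eq_iff lookup_add)
    then show ?thesis
      unfolding D_def by (intro derivation_euler_derivation) (simp add: deg_def ladd)
  qed
  have deg_diff: "deg v (expo (vec_pos w)) - deg v (expo (vec_neg w)) = l v w" for v w
  proof -
    have "(\<chi> i. int (Poly_Mapping.lookup (expo (vec_pos w)) i)) =
        w + (\<chi> i. int (Poly_Mapping.lookup (expo (vec_neg w)) i))"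
      by (simp add: vec_eq_iff vec_pos_def vec_neg_def)
    then show ?thesis by (simp add: deg_def ladd)
  qed
  have pJ: "p v \<in> J" if "v \<in> C" for v
    unfolding p_def by (intro subspace_scale_right[OF subJ] fJ that)
  define E where "E x = (\<Sum>v\<in>C. p v * D v x)" for x
  have derE: "derivation E"
    unfolding E_def by (intro derivation_combination der)
  have EJ: "E x \<in> J" for x
    unfolding E_def using pJ by (intro ring_ideal.subspace_sum[OF subJ] subspace_scale_right[OF subJ])
  have Ef: "E (?f w) - u * ?f w \<in> ideal_power J 2" if w: "w \<in> C" for w
  proof -
    \<comment> \<open>The error in \<open>J\<^sup>2\<close>: it comes from the weight of the monomial by which \<open>f\<^sub>w\<close> differs from \<open>y\<^sub>w - 1\<close>.\<close>
    define c where "c v = mvConst (deg v (expo (vec_neg w))) * (p v * ?f w)" for v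
    have "p v * D v (?f w) = (if v = w then p v * mvMonom (vec_pos w) else 0) + c v"
      if "v \<in> C" for v
      using dual[OF that w]
      by (simp add: D_def euler_lattice_binomial deg_diff c_def mvConst_def algebra_simps)
    then have "E (?f w) = (\<Sum>v\<in>C. (if v = w then p v * mvMonom (vec_pos w) else 0) + c v)"
      unfolding E_def by (intro sum.cong) auto
    also have "\<dots> = p w * mvMonom (vec_pos w) + (\<Sum>v\<in>C. c v)"
      using fin w by (simp add: sum.distrib)
    also have "p w * mvMonom (vec_pos w) = u * ?f w"
      unfolding p_def u_def by (simp add: prod.remove[OF fin w, of "\<lambda>v. mvMonom (vec_pos v)"] mult_ac)
    finally have "E (?f w) - u * ?f w = (\<Sum>v\<in>C. c v)" by simp
    moreover have "c v \<in> ideal_power J 2" if "v \<in> C" for v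
      unfolding c_def using ideal_mult_mem[OF pJ[OF that] fJ[OF w]] ring_ideal.subspace_scale[OF sub]
      by (simp add: J2)
    ultimately show ?thesis
      using ring_ideal.subspace_sum[OF sub] by metis
  qed
  have "E x - u * x \<in> ideal_power J 2" if "x \<in> J" for x
    using that unfolding J
  proof (induction rule: ring_ideal.span_induct_alt)
    case base
    then show ?case
      using ring_ideal.subspace_0[OF subspace_ideal_power] by (simp add: derivation_zero[OF derE])
  next
    case (step c x y)
    note step = step[folded J]
    have "E c * x \<in> ideal_power J 2"
      using step(1) EJ fJ ideal_mult_mem J2 by blast
    moreover have "c * (E x - u * x) \<in> ideal_power J 2"
      using step(1) Ef ring_ideal.subspace_scale[OF sub] by blast
    ultimately have "E c * x + c * (E x - u * x) + (E y - u * y) \<in> ideal_power J 2"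
      using step(2) ring_ideal.subspace_add[OF sub] by blast
    then show ?case
      unfolding J[symmetric]
      by (simp add: derivation_add[OF derE] derivation_mult[OF derE] algebra_simps)
  qed
  moreover have "\<exists>b. (\<Prod>v\<in>S. mvMonom (vec_pos v)) dvd
      (\<Prod>i\<in>UNIV. mvVar i :: ('n, 'k) mvpoly) ^ b" if "finite S" for S :: "(int ^ 'n) set"
    using that
  proof induction
    case (insert v S)
    obtain b where b: "mvMonom (vec_pos v) dvd (\<Prod>i\<in>UNIV. mvVar i :: ('n, 'k) mvpoly) ^ b"
      using mvMonom_dvd_power by metis
    obtain b' where b': "(\<Prod>v\<in>S. mvMonom (vec_pos v)) dvd
        (\<Prod>i\<in>UNIV. mvVar i :: ('n, 'k) mvpoly) ^ b'"
      using insert.IH by metis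
    show ?case
      using mult_dvd_mono[OF b b'] insert.hyps by (auto simp flip: power_add)
  qed simp
  then obtain b where "u dvd (\<Prod>i\<in>UNIV. mvVar i) ^ b"
    unfolding u_def using fin by metis
  ultimately show ?thesis
    using der pJ by (intro that[of D p u b]) (auto simp: E_def)
qed

theorem mainTheorem4:
  fixes A :: "nat ^ 'n::finite ^ 'm::finite"
    and C :: "(int ^ 'n) set"
    and J :: "('n, 'k::{alg_closed_field, field_char_0}) mvpoly set"
    and t :: nat
  assumes "\<And>i. column i A \<noteq> 0"
    and "lattice_basis C (matrix_kernel A)"
    and "J = ring_ideal.span (lattice_binomial ` C)"
    and "t \<ge> 1"
  shows "symbolic_power (toric_ideal A) t
           = saturation (ideal_power J t) (\<Prod>i\<in>UNIV. mvVar i)"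
proof -
  let ?h = "\<Prod>i\<in>UNIV. mvVar i :: ('n, 'k) mvpoly"
  let ?I = "toric_ideal A :: ('n, 'k) mvpoly set"
  have ind: "int_lattice.independent C" and span: "int_lattice.span C = matrix_kernel A"
    using assms(2) by (auto simp: lattice_basis_def)
  have subJ: "ring_ideal.subspace J" by (simp add: assms(3))
  have JI: "J \<subseteq> ?I"
    unfolding assms(3)
    by (intro ring_ideal.span_minimal toric_ideal_subspace)
      (use span int_lattice.span_base in \<open>auto intro!: lattice_binomial_in_toric_ideal\<close>)
  have h: "?h ^ a \<notin> ?I" for a
    using mvMonom_notin_toric_ideal[of "\<chi> i. a" A] by (simp add: mvMonom_def prod_power_distrib)
  have "saturation J ?h \<subseteq> ?I"
    using JI toric_ideal_prime h unfolding saturation_def by blast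
  moreover have IJ: "?I \<subseteq> saturation J ?h"
    unfolding assms(3) by (rule toric_ideal_subset_saturation[OF span])
  ultimately have I: "?I = saturation J ?h" by blast
  show ?thesis
  proof
    show "saturation (ideal_power J t) ?h \<subseteq> symbolic_power ?I t"
      using ideal_power_mono[OF JI] h unfolding saturation_def symbolic_power_def by blast
  next
    obtain D :: "int ^ 'n \<Rightarrow> ('n, 'k) mvpoly \<Rightarrow> ('n, 'k) mvpoly" and p u b where
      D: "\<And>v. derivation (D v)" "\<And>v. v \<in> C \<Longrightarrow> p v \<in> J"
      "\<And>x. x \<in> J \<Longrightarrow> (\<Sum>v\<in>C. p v * D v x) - u * x \<in> ideal_power J 2" "u dvd ?h ^ b"
      using lattice_ideal_euler[OF ind assms(3)] by blast
    have char0: "(of_nat s :: ('n, 'k) mvpoly) dvd 1" if "s > 0" for s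
    proof
      show "1 = of_nat s * (mvConst (1 / of_nat s) :: ('n, 'k) mvpoly)"
        using that by (simp add: mvConst_def mult_single flip: single_of_nat)
    qed
    show "symbolic_power ?I t \<subseteq> saturation (ideal_power J t) ?h"
    proof
      fix f assume "f \<in> symbolic_power ?I t"
      then obtain g where g: "g \<notin> ?I" and fg: "f * g \<in> ideal_power ?I t"
        by (auto simp: symbolic_power_def)
      have "f * g \<in> saturation (ideal_power J t) ?h"
        using ideal_power_saturation_subset fg[unfolded I] by (rule subsetD)
      then show "f \<in> saturation (ideal_power J t) ?h"
      proof (rule saturation_power_cancel[OF subJ _ D(1,2) _ D(4) char0, rotated -1])
        show "g \<notin> saturation J ?h"
          using g I by simp
        show "f \<in> saturation J ?h \<or> g \<in> saturation J ?h"
          if "f * g \<in> saturation J ?h" for f g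
          using toric_ideal_prime that unfolding I[symmetric] by blast
      qed (use D(3) in simp_all)
    qed
  qed
qed

end
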